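(* Let $C_n=\frac{1}{n+1}\binom{2n}{n}$ be the $n$-th Catalan number and let $M(n)$ be the arithmetic cost of multiplying truncated power series in $\mathbb{C}[[t]]/(t^{n+1})$. The cost of the classical algorithm for free cumulants by explicit enumeration of non-crossing partitions satisfies $$L_{\mathrm{classical}}(\mathcal{C}_n^{\mathrm{free}})=\Theta(n\cdot C_n)=\omega(M(n)).$$
   Context: $\mathcal{C}_n^{\mathrm{free}}$ is the problem of relating moments and free cumulants up to order $n$. The classical algorithm evaluates the moment–cumulant formula $\mu_n=\sum_{\pi\in NC(n)}\prod_{V\in\pi}\kappa^{\mathrm{free}}_{|V|}$ by explicitly enumerating all non-crossing partitions $\pi\in NC(n)$ of $\{1,\dots,n\}$ (of which there are $C_n$), where processing each partition takes time linear in $n$. $L_{\mathrm{classical}}$ is the cost of this specific algorithm. $M(n)=O(n\log n)$. *)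

theory Defs
  imports
    Complex_Main
    "HOL-Library.Disjoint_Sets"
    "HOL-Library.Landau_Symbols"
    "HOL-Computational_Algebra.Formal_Power_Series"
begin

definition catalan :: "nat \<Rightarrow> real" where
  "catalan n = 1 / (real n + 1) * real ((2 * n) choose n)"

definition noncrossing :: "nat set set \<Rightarrow> bool" where
  "noncrossing \<pi> \<longleftrightarrow>
     \<not> (\<exists>V\<in>\<pi>. \<exists>W\<in>\<pi>. V \<noteq> W \<and>
          (\<exists>a\<in>V. \<exists>b\<in>W. \<exists>c\<in>V. \<exists>d\<in>W. a < b \<and> b < c \<and> c < d))"

definition NC :: "nat \<Rightarrow> nat set set set" where
  "NC n = {\<pi>. partition_on {1..n} \<pi> \<and> noncrossing \<pi>}"


text \<open>
  The classical algorithm, run on free cumulants \<open>\<kappa>\<close>. At order \<open>m\<close> it visits every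
  non-crossing partition of \<open>{1..m}\<close> once, adding the contribution of the partition to the
  moment. Computations are modelled as pairs (value, time). The parameter \<open>t m \<pi>\<close> is the time
  spent on the single partition \<open>\<pi>\<close> (producing it, reading its blocks, forming the product of
  cumulants and adding it to the running sum); it depends on the implementation and the
  machine, and the only thing required of it is \<open>linear_time\<close> below.
\<close>

definition classical_moment ::
    "(nat \<Rightarrow> nat set set \<Rightarrow> real) \<Rightarrow> (nat \<Rightarrow> complex) \<Rightarrow> nat \<Rightarrow> complex \<times> real" where
  "classical_moment t \<kappa> m =
     (\<Sum>\<pi>\<in>NC m. \<Prod>V\<in>\<pi>. \<kappa> (card V), \<Sum>\<pi>\<in>NC m. t m \<pi>)"

text \<open>Up to order \<open>n\<close>: the moments of orders \<open>1, \<dots>, n\<close>, one after the other.\<close>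

definition classical_moments ::
    "(nat \<Rightarrow> nat set set \<Rightarrow> real) \<Rightarrow> (nat \<Rightarrow> complex) \<Rightarrow> nat \<Rightarrow> complex list \<times> real" where
  "classical_moments t \<kappa> n =
     (map (\<lambda>m. fst (classical_moment t \<kappa> m)) [1..<Suc n],
      \<Sum>m=1..n. snd (classical_moment t \<kappa> m))"

definition L_classical ::
    "(nat \<Rightarrow> nat set set \<Rightarrow> real) \<Rightarrow> (nat \<Rightarrow> complex) \<Rightarrow> nat \<Rightarrow> real" where
  "L_classical t \<kappa> n = snd (classical_moments t \<kappa> n)"

text \<open>The constants are uniform over all partitions of the same order.\<close>

definition linear_time :: "(nat \<Rightarrow> nat set set \<Rightarrow> real) \<Rightarrow> bool" where
  "linear_time t \<longleftrightarrow>
     (\<exists>a>0. \<exists>b. \<forall>\<^sub>F m in sequentially.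
        \<forall>\<pi>\<in>NC m. a * real m \<le> t m \<pi> \<and> t m \<pi> \<le> b * real m)"

text \<open>
  For instance, reading each of the \<open>m\<close> points once, with one multiplication per block and
  one addition to the running sum.
\<close>

lemma linear_time_unit_cost: "linear_time (\<lambda>m \<pi>. real m + real (card \<pi>) + 1)"
proof -
  have card_le: "card \<pi> \<le> m" if "\<pi> \<in> NC m" for m \<pi>
  proof -
    have p: "partition_on {1..m} \<pi>"
      using that by (simp add: NC_def)
    have "inj_on Min \<pi>"
    proof (rule inj_onI)
      fix V W assume V: "V \<in> \<pi>" and W: "W \<in> \<pi>" and eq: "Min V = Min W"
      have "finite V" "V \<noteq> {}" "finite W" "W \<noteq> {}"
        using p V W
        by (auto simp: partition_on_def intro: finite_subset[OF _ finite_atLeastAtMost])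
      then have "Min V \<in> V" "Min V \<in> W"
        using eq Min_in[of V] Min_in[of W] by simp_all
      then show "V = W"
        using p V W by (auto simp: partition_on_def disjoint_def)
    qed
    moreover have "Min ` \<pi> \<subseteq> {1..m}"
    proof
      fix x assume "x \<in> Min ` \<pi>"
      then obtain V where V: "V \<in> \<pi>" "x = Min V" by auto
      have "finite V" "V \<noteq> {}" "V \<subseteq> {1..m}"
        using p V
        by (auto simp: partition_on_def intro: finite_subset[OF _ finite_atLeastAtMost])
      then show "x \<in> {1..m}" using V Min_in by blast
    qed
    ultimately have "card \<pi> \<le> card {1..m}"
      by (intro card_inj_on_le) auto
    then show ?thesis by simp
  qed
  have "\<forall>\<^sub>F m in sequentially. \<forall>\<pi>\<in>NC m. 1 * real m \<le> real m + real (card \<pi>) + 1 \<and>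
          real m + real (card \<pi>) + 1 \<le> 3 * real m"
    using eventually_ge_at_top[of 1] by eventually_elim (use card_le in force)
  then show ?thesis
    unfolding linear_time_def by (intro exI[of _ 1] exI[of _ 3] conjI) simp_all
qed


text \<open>
  Arithmetic cost over \<open>\<complex>\<close>: straight-line programs, in which additions, subtractions and
  multiplications cost one unit each and loading a scalar is free. The first argument of an
  instruction is its target register.
\<close>

datatype instr =
    Load nat complex
  | Add nat nat nat
  | Sub nat nat nat
  | Mult nat nat nat

fun exec :: "instr \<Rightarrow> (nat \<Rightarrow> complex) \<Rightarrow> (nat \<Rightarrow> complex)" where
  "exec (Load r c) s = s(r := c)"
| "exec (Add r i j) s = s(r := s i + s j)"
| "exec (Sub r i j) s = s(r := s i - s j)"
| "exec (Mult r i j) s = s(r := s i * s j)"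

fun instr_cost :: "instr \<Rightarrow> nat" where
  "instr_cost (Load r c) = 0"
| "instr_cost (Add r i j) = 1"
| "instr_cost (Sub r i j) = 1"
| "instr_cost (Mult r i j) = 1"

definition run :: "instr list \<Rightarrow> (nat \<Rightarrow> complex) \<Rightarrow> (nat \<Rightarrow> complex)" where
  "run p s = fold exec p s"

definition prog_cost :: "instr list \<Rightarrow> nat" where
  "prog_cost p = (\<Sum>i\<leftarrow>p. instr_cost i)"

text \<open>
  An element of \<open>\<complex>[[t]]/(t^(n+1))\<close> is given by its coefficients \<open>0, \<dots>, n\<close>. Those of \<open>f\<close> are
  stored in registers \<open>0, \<dots>, n\<close> and those of \<open>g\<close> in registers \<open>n + 1, \<dots>, 2 n + 1\<close>; all
  other registers start at \<open>0\<close>.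
\<close>

definition input_state :: "nat \<Rightarrow> complex fps \<Rightarrow> complex fps \<Rightarrow> (nat \<Rightarrow> complex)" where
  "input_state n f g r =
     (if r \<le> n then fps_nth f r
      else if r \<le> 2 * n + 1 then fps_nth g (r - (n + 1))
      else 0)"

text \<open>The output registers \<open>out k\<close> may be chosen freely, but independently of the input.\<close>

definition multiplies_truncated :: "nat \<Rightarrow> instr list \<Rightarrow> bool" where
  "multiplies_truncated n p \<longleftrightarrow>
     (\<exists>out :: nat \<Rightarrow> nat. \<forall>f g. \<forall>k\<le>n. run p (input_state n f g) (out k) = fps_nth (f * g) k)"

definition mult_cost :: "nat \<Rightarrow> nat" where
  "mult_cost n = (LEAST c. \<exists>p. multiplies_truncated n p \<and> prog_cost p = c)"

end

theory Submission
  imports Defs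
begin

text \<open>
  The cost of the classical algorithm at order \<open>m\<close> lies between constant multiples of
  \<open>m * card (NC m)\<close>, so three facts are needed.

  The non-crossing partitions are counted by the Catalan numbers (\<open>card_NC\<close>). Classifying the
  partitions of \<open>{1..n + 1}\<close> by the predecessor \<open>k\<close> of \<open>n + 1\<close> in its block (with \<open>k = 0\<close> if there is
  none) splits them into a non-crossing partition of \<open>{1..k}\<close> and one of \<open>{k + 1..n}\<close>, which gives
  Segner's recurrence (\<open>card_NC_Suc\<close>); the closed form satisfies the same recurrence
  (\<open>catalan_convolution\<close>).

  Computing all orders up to \<open>n\<close> costs no more than order \<open>n\<close> alone, up to a constant factor:
  \<open>m * catalan m\<close> at least doubles when \<open>m\<close> increases by one, so the sum over \<open>m\<close> is dominated by
  its last term (\<open>sum_bigtheta_last\<close>).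

  Finally, \<open>n * catalan n\<close> grows exponentially. Therefore any polynomial bound on the cost of
  multiplication suffices for the comparison, and schoolbook multiplication gives one:
  \<open>mult_cost n \<le> 2 * (n + 1)\<^sup>2\<close> (\<open>mult_cost_le\<close>).
\<close>

section \<open>Non-crossing equivalence relations\<close>

text \<open>
  A partition is encoded by the relation ``lies in the same block''. Restricting a partition to a
  subset then is an intersection, with no empty blocks to discard, and joining two partitions
  along a point is a union, so the bijections below reduce to statements about pairs.
\<close>
definition ncrel :: "nat set \<Rightarrow> (nat \<times> nat) set set" where
  "ncrel A = {E. equiv A E \<and>
     (\<forall>a b c d. a < b \<and> b < c \<and> c < d \<and> (a, c) \<in> E \<and> (b, d) \<in> E \<longrightarrow> (a, b) \<in> E)}"

lemma ncrelI:
  assumes "\<And>x y. (x, y) \<in> E \<Longrightarrow> x \<in> A \<and> y \<in> A"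
    and "\<And>x. x \<in> A \<Longrightarrow> (x, x) \<in> E"
    and "\<And>x y. (x, y) \<in> E \<Longrightarrow> (y, x) \<in> E"
    and "\<And>x y z. (x, y) \<in> E \<Longrightarrow> (y, z) \<in> E \<Longrightarrow> (x, z) \<in> E"
    and "\<And>a b c d. a < b \<Longrightarrow> b < c \<Longrightarrow> c < d \<Longrightarrow> (a, c) \<in> E \<Longrightarrow> (b, d) \<in> E \<Longrightarrow> (a, b) \<in> E"
  shows "E \<in> ncrel A"
proof -
  have "equiv A E"
  proof (rule equivI)
    show "E \<subseteq> A \<times> A" using assms(1) by auto
    show "refl_on A E" using assms(2) by (simp add: refl_on_def)
    show "sym E" using assms(3) by (rule symI)
    show "trans E" using assms(4) by (rule transI)
  qed
  then show ?thesis
    unfolding ncrel_def using assms(5) by blast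
qed

lemma ncrelD:
  assumes "E \<in> ncrel A"
  shows "(x, y) \<in> E \<Longrightarrow> x \<in> A" "(x, y) \<in> E \<Longrightarrow> y \<in> A"
    and "x \<in> A \<Longrightarrow> (x, x) \<in> E"
    and "(x, y) \<in> E \<Longrightarrow> (y, x) \<in> E"
    and "(x, y) \<in> E \<Longrightarrow> (y, z) \<in> E \<Longrightarrow> (x, z) \<in> E"
    and "a < b \<Longrightarrow> b < c \<Longrightarrow> c < d \<Longrightarrow> (a, c) \<in> E \<Longrightarrow> (b, d) \<in> E \<Longrightarrow> (a, b) \<in> E"
proof -
  have E: "E \<subseteq> A \<times> A" "refl_on A E" "sym E" "trans E"
    using assms by (auto simp: ncrel_def equiv_def)
  show "(x, y) \<in> E \<Longrightarrow> x \<in> A" "(x, y) \<in> E \<Longrightarrow> y \<in> A" using E(1) by auto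
  show "x \<in> A \<Longrightarrow> (x, x) \<in> E" using E(2) by (simp add: refl_on_def)
  show "(x, y) \<in> E \<Longrightarrow> (y, x) \<in> E" using E(3) by (rule symD)
  show "(x, y) \<in> E \<Longrightarrow> (y, z) \<in> E \<Longrightarrow> (x, z) \<in> E" using E(4) by (rule transD)
  show "a < b \<Longrightarrow> b < c \<Longrightarrow> c < d \<Longrightarrow> (a, c) \<in> E \<Longrightarrow> (b, d) \<in> E \<Longrightarrow> (a, b) \<in> E"
    using assms unfolding ncrel_def by blast
qed

lemma finite_ncrel: "finite A \<Longrightarrow> finite (ncrel A)"
  by (rule finite_subset[of _ "Pow (A \<times> A)"]) (auto simp: ncrel_def equiv_def)

lemma card_NC_eq_card_ncrel: "card (NC n) = card (ncrel {1..n})"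
proof -
  let ?A = "{1..n}"
  have "bij_betw (\<lambda>E. ?A // E) (ncrel ?A) (NC n)"
  proof (rule bij_betw_byWitness[where f' = "\<lambda>\<pi>. {(x, y). \<exists>V\<in>\<pi>. x \<in> V \<and> y \<in> V}"])
    show "\<forall>E\<in>ncrel ?A. {(x, y). \<exists>V\<in>?A // E. x \<in> V \<and> y \<in> V} = E"
    proof
      fix E assume E: "E \<in> ncrel ?A"
      show "{(x, y). \<exists>V\<in>?A // E. x \<in> V \<and> y \<in> V} = E"
      proof (intro equalityI subrelI)
        have eq: "equiv ?A E" using E by (simp add: ncrel_def)
        fix x y
        show "(x, y) \<in> E" if "(x, y) \<in> {(x, y). \<exists>V\<in>?A // E. x \<in> V \<and> y \<in> V}"
          using that quotient_eq_iff[OF eq] by blast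
        show "(x, y) \<in> {(x, y). \<exists>V\<in>?A // E. x \<in> V \<and> y \<in> V}" if "(x, y) \<in> E"
        proof -
          have x: "x \<in> ?A" using ncrelD(1)[OF E that] .
          have "x \<in> E `` {x}" "y \<in> E `` {x}" using that ncrelD(3)[OF E x] by auto
          then show ?thesis using quotientI[OF x, of E] by auto
        qed
      qed
    qed
    show "\<forall>\<pi>\<in>NC n. ?A // {(x, y). \<exists>V\<in>\<pi>. x \<in> V \<and> y \<in> V} = \<pi>"
      using partition_on_eq_quotient by (auto simp: NC_def)
    show "(\<lambda>E. ?A // E) ` ncrel ?A \<subseteq> NC n"
    proof clarify
      fix E assume E: "E \<in> ncrel ?A"
      have eq: "equiv ?A E" using E by (simp add: ncrel_def)
      have "noncrossing (?A // E)"
        unfolding noncrossing_def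
      proof clarify
        fix V W a b c d
        assume *: "V \<in> ?A // E" "W \<in> ?A // E" "V \<noteq> W" "a \<in> V" "b \<in> W" "c \<in> V" "d \<in> W"
          "a < b" "b < c" "c < d"
        have "(a, c) \<in> E" "(b, d) \<in> E"
          using * quotient_eq_iff[OF eq] by blast+
        then have "(a, b) \<in> E" using ncrelD(6)[OF E] * by blast
        then show False using * quotient_eq_iff[OF eq] by blast
      qed
      then show "?A // E \<in> NC n"
        using partition_on_quotient[OF eq] by (simp add: NC_def)
    qed
    show "(\<lambda>\<pi>. {(x, y). \<exists>V\<in>\<pi>. x \<in> V \<and> y \<in> V}) ` NC n \<subseteq> ncrel ?A"
    proof clarify
      fix \<pi> assume pi: "\<pi> \<in> NC n"
      then have eq: "equiv ?A {(x, y). \<exists>V\<in>\<pi>. x \<in> V \<and> y \<in> V}" and nc: "noncrossing \<pi>"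
        using equiv_partition_on by (auto simp: NC_def)
      let ?E = "{(x, y). \<exists>V\<in>\<pi>. x \<in> V \<and> y \<in> V}"
      have "\<forall>a b c d. a < b \<and> b < c \<and> c < d \<and> (a, c) \<in> ?E \<and> (b, d) \<in> ?E \<longrightarrow> (a, b) \<in> ?E"
      proof (intro allI impI)
        fix a b c d
        assume "a < b \<and> b < c \<and> c < d \<and> (a, c) \<in> ?E \<and> (b, d) \<in> ?E"
        then obtain V W where *: "V \<in> \<pi>" "W \<in> \<pi>" "a \<in> V" "c \<in> V" "b \<in> W" "d \<in> W"
            "a < b" "b < c" "c < d"
          by auto
        then have "V = W" using nc unfolding noncrossing_def by metis
        then show "(a, b) \<in> ?E" using * by auto
      qed
      with eq show "?E \<in> ncrel ?A" unfolding ncrel_def by (intro CollectI conjI)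
    qed
  qed
  then show ?thesis by (metis bij_betw_same_card)
qed

text \<open>
  Only the order of the points matters for crossings, so the number of non-crossing relations on an
  interval depends on its length alone.
\<close>
lemma card_ncrel_image:
  assumes "strict_mono (f :: nat \<Rightarrow> nat)"
  shows "card (ncrel (f ` A)) = card (ncrel A)"
proof -
  have lt: "f x < f y \<longleftrightarrow> x < y" for x y using assms by (rule strict_mono_less)
  have inj: "f x = f y \<longleftrightarrow> x = y" for x y using assms by (rule strict_mono_eq)
  have "bij_betw (\<lambda>E. map_prod f f ` E) (ncrel A) (ncrel (f ` A))"
  proof (rule bij_betw_byWitness[where f' = "\<lambda>E. {(x, y). (f x, f y) \<in> E}"])
    show "\<forall>E\<in>ncrel A. {(x, y). (f x, f y) \<in> map_prod f f ` E} = E"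
      by (auto simp: inj)
    show "\<forall>E\<in>ncrel (f ` A). map_prod f f ` {(x, y). (f x, f y) \<in> E} = E"
    proof
      fix E assume E: "E \<in> ncrel (f ` A)"
      show "map_prod f f ` {(x, y). (f x, f y) \<in> E} = E"
        using ncrelD(1,2)[OF E] by (force simp: image_iff)
    qed
    show "(\<lambda>E. map_prod f f ` E) ` ncrel A \<subseteq> ncrel (f ` A)"
    proof clarify
      fix E assume E: "E \<in> ncrel A"
      show "map_prod f f ` E \<in> ncrel (f ` A)"
      proof (rule ncrelI)
        fix x y z assume "(x, y) \<in> map_prod f f ` E" "(y, z) \<in> map_prod f f ` E"
        then obtain u v w where "x = f u" "y = f v" "z = f w" "(u, v) \<in> E" "(v, w) \<in> E"
          by (auto simp: inj)
        then show "(x, z) \<in> map_prod f f ` E" using ncrelD(5)[OF E] by auto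
      next
        fix a b c d
        assume less: "a < b" "b < c" "c < d"
          and "(a, c) \<in> map_prod f f ` E" "(b, d) \<in> map_prod f f ` E"
        then obtain a' b' c' d' where "a = f a'" "b = f b'" "c = f c'" "d = f d'"
            "(a', c') \<in> E" "(b', d') \<in> E"
          by auto
        moreover from this less have "(a', b') \<in> E"
          using ncrelD(6)[OF E, of a' b' c' d'] by (simp add: lt)
        ultimately show "(a, b) \<in> map_prod f f ` E" by auto
      qed (use ncrelD(1-4)[OF E] in auto)
    qed
    show "(\<lambda>E. {(x, y). (f x, f y) \<in> E}) ` ncrel (f ` A) \<subseteq> ncrel A"
    proof clarify
      fix E assume E: "E \<in> ncrel (f ` A)"
      show "{(x, y). (f x, f y) \<in> E} \<in> ncrel A"
      proof (rule ncrelI)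
        fix x y assume "(x, y) \<in> {(x, y). (f x, f y) \<in> E}"
        then show "x \<in> A \<and> y \<in> A"
          using ncrelD(1,2)[OF E, of "f x" "f y"] by (auto simp: inj)
      next
        fix a b c d assume "a < b" "b < c" "c < d"
          and "(a, c) \<in> {(x, y). (f x, f y) \<in> E}" "(b, d) \<in> {(x, y). (f x, f y) \<in> E}"
        then show "(a, b) \<in> {(x, y). (f x, f y) \<in> E}"
          using ncrelD(6)[OF E, of "f a" "f b" "f c" "f d"] by (simp add: lt)
      qed (use ncrelD(3-5)[OF E] in blast)+
    qed
  qed
  then show ?thesis by (metis bij_betw_same_card)
qed

section \<open>The recurrence for the number of non-crossing partitions\<close>

text \<open>
  The new point \<open>z\<close> joins the block of \<open>k\<close> in \<open>E\<close>, and \<open>F\<close> is placed between \<open>k\<close> and \<open>z\<close>.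
  When \<open>k = 0\<close>, which is no point of the ground set, \<open>z\<close> becomes a block of its own.
\<close>
definition glue :: "nat \<Rightarrow> nat \<Rightarrow> (nat \<times> nat) set \<Rightarrow> (nat \<times> nat) set \<Rightarrow> (nat \<times> nat) set" where
  "glue k z E F = E \<union> F \<union> {(z, z)} \<union> {(z, x) | x. (x, k) \<in> E} \<union> {(x, z) | x. (x, k) \<in> E}"

text \<open>
  The relations in which \<open>k\<close> is the element preceding \<open>n + 1\<close> in its block; \<open>k = 0\<close> stands for
  the absence of such an element.
\<close>
definition ncrel_pred :: "nat \<Rightarrow> nat \<Rightarrow> (nat \<times> nat) set set" where
  "ncrel_pred n k = {E \<in> ncrel {1..Suc n}. (k = 0 \<or> (k, Suc n) \<in> E) \<and>
     (\<forall>j. k < j \<longrightarrow> j \<le> n \<longrightarrow> (j, Suc n) \<notin> E)}"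

text \<open>
  No crossing arises: within the union of the points of \<open>E\<close> and the new point, the latter comes
  directly after \<open>k\<close>, so a crossing that uses it gives one that uses \<open>k\<close> instead; and all of \<open>F\<close>
  lies in the single gap between \<open>k\<close> and the new point.
\<close>
lemma glue_in_ncrel_pred:
  assumes E: "E \<in> ncrel {1..k}" and F: "F \<in> ncrel {k+1..n}" and k: "k \<le> n"
  shows "glue k (Suc n) E F \<in> ncrel_pred n k"
proof -
  let ?G = "glue k (Suc n) E F"
  have E12: "1 \<le> x \<and> x \<le> k \<and> 1 \<le> y \<and> y \<le> k" if "(x, y) \<in> E" for x y
    using ncrelD(1,2)[OF E that] by auto
  have F12: "k < x \<and> x \<le> n \<and> k < y \<and> y \<le> n" if "(x, y) \<in> F" for x y
    using ncrelD(1,2)[OF F that] by auto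
  have "?G \<in> ncrel {1..Suc n}"
  proof (rule ncrelI)
    fix x y assume "(x, y) \<in> ?G"
    then show "x \<in> {1..Suc n} \<and> y \<in> {1..Suc n}"
      using k by (auto simp: glue_def dest!: E12 F12)
  next
    fix x assume x: "x \<in> {1..Suc n}"
    then consider "x \<in> {1..k}" | "x \<in> {k+1..n}" | "x = Suc n" by force
    then show "(x, x) \<in> ?G"
      by cases (auto simp: glue_def intro: ncrelD(3)[OF E] ncrelD(3)[OF F])
  next
    fix x y assume "(x, y) \<in> ?G"
    then show "(y, x) \<in> ?G"
      by (auto simp: glue_def intro: ncrelD(4)[OF E] ncrelD(4)[OF F])
  next
    fix x y z assume xy: "(x, y) \<in> ?G" "(y, z) \<in> ?G"
    have noz: "(Suc n, u) \<notin> E" "(u, Suc n) \<notin> E" "(Suc n, u) \<notin> F" "(u, Suc n) \<notin> F" for u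
      using E12 F12 k by fastforce+
    have dj: "\<not> ((u, v) \<in> E \<and> (v, w) \<in> F)" "\<not> ((u, v) \<in> F \<and> (v, w) \<in> E)" for u v w
      using E12[of u v] F12[of v w] E12[of v w] F12[of u v] by auto
    show "(x, z) \<in> ?G"
      using xy noz dj unfolding glue_def
      by (elim UnE CollectE exE conjE Pair_inject insertE emptyE; hypsubst?)
        (auto dest: ncrelD(4)[OF E] ncrelD(5)[OF E] ncrelD(5)[OF F])
  next
    fix a b c d assume less: "a < b" "b < c" "c < d" and "(a, c) \<in> ?G" "(b, d) \<in> ?G"
    moreover from this have "d \<le> Suc n" using k by (auto simp: glue_def dest!: E12 F12)
    ultimately have ac: "(a, c) \<in> E \<or> (a, c) \<in> F"
      and bd: "(b, d) \<in> E \<or> (b, d) \<in> F \<or> d = Suc n \<and> (b, k) \<in> E"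
      by (auto simp: glue_def)
    from ac show "(a, b) \<in> ?G"
    proof
      assume aE: "(a, c) \<in> E"
      have "(a, b) \<in> E"
        using bd
      proof (elim disjE conjE)
        assume "(b, d) \<in> E"
        then show ?thesis using ncrelD(6)[OF E less aE] by simp
      next
        assume "(b, d) \<in> F"
        then show ?thesis using E12[OF aE] F12[of b d] less by auto
      next
        assume bk: "(b, k) \<in> E"
        show ?thesis
        proof (cases "c = k")
          case True
          then show ?thesis using ncrelD(5)[OF E aE] ncrelD(4)[OF E bk] by simp
        next
          case False
          then have "c < k" using E12[OF aE] by simp
          then show ?thesis using ncrelD(6)[OF E less(1,2) _ aE bk] by simp
        qed
      qed
      then show ?thesis by (simp add: glue_def)
    next
      assume aF: "(a, c) \<in> F"
      then have "(b, d) \<in> F" using bd F12[OF aF] E12[of b] less by force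
      then have "(a, b) \<in> F" using ncrelD(6)[OF F less aF] by simp
      then show ?thesis by (simp add: glue_def)
    qed
  qed
  moreover have "k = 0 \<or> (k, Suc n) \<in> ?G"
    using ncrelD(3)[OF E, of k] by (auto simp: glue_def)
  moreover have "(j, Suc n) \<notin> ?G" if "k < j" "j \<le> n" for j
    using that k by (auto simp: glue_def dest!: E12 F12)
  ultimately show ?thesis by (simp add: ncrel_pred_def)
qed

lemma ncrel_restrict:
  assumes "E \<in> ncrel A" "B \<subseteq> A"
  shows "E \<inter> B \<times> B \<in> ncrel B"
  by (rule ncrelI) (use assms(2) in \<open>auto intro: ncrelD[OF assms(1)]\<close>)

text \<open>
  Gluing is inverse to restriction because no block can join a point \<open>x \<le> k\<close> to a point \<open>y\<close>
  strictly between \<open>k\<close> and \<open>n + 1\<close>. If \<open>x < k\<close>, such a block would cross the one through \<open>k\<close>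
  and \<open>n + 1\<close> unless it is that block; in either case \<open>y\<close> would lie in the block of \<open>n + 1\<close>,
  after its predecessor \<open>k\<close>.
\<close>
lemma glue_restrict:
  assumes G: "G \<in> ncrel_pred n k" and k: "k \<le> n"
  shows "glue k (Suc n) (G \<inter> {1..k} \<times> {1..k}) (G \<inter> {k+1..n} \<times> {k+1..n}) = G"
proof -
  let ?z = "Suc n"
  have nc: "G \<in> ncrel {1..?z}" and kz: "k = 0 \<or> (k, ?z) \<in> G"
    and gap: "\<And>j. k < j \<Longrightarrow> j \<le> n \<Longrightarrow> (j, ?z) \<notin> G"
    using G by (auto simp: ncrel_pred_def)
  have sep: "(x, y) \<notin> G" if "1 \<le> x" "x \<le> k" "k < y" "y \<le> n" for x y
  proof
    assume xy: "(x, y) \<in> G"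
    have kz': "(k, ?z) \<in> G" using kz that by auto
    have "(x, k) \<in> G"
    proof (cases "x = k")
      case True
      then show ?thesis using ncrelD(3)[OF nc, of k] that by auto
    next
      case False
      then show ?thesis using ncrelD(6)[OF nc _ _ _ xy kz'] that by auto
    qed
    then have "(y, ?z) \<in> G" using xy kz' ncrelD(4,5)[OF nc] by blast
    then show False using gap that by blast
  qed
  have xz: "(x, ?z) \<in> G \<longleftrightarrow> (x, k) \<in> G" if "1 \<le> x" "x \<le> k" for x
  proof -
    have kz': "(k, ?z) \<in> G" using kz that by auto
    show ?thesis
      using ncrelD(5)[OF nc _ kz'] ncrelD(5)[OF nc _ ncrelD(4)[OF nc kz']] by blast
  qed
  have sep': "(y, x) \<notin> G" if "1 \<le> x" "x \<le> k" "k < y" "y \<le> n" for x y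
    using sep[OF that] ncrelD(4)[OF nc] by blast
  have zx: "(?z, x) \<in> G \<longleftrightarrow> (x, k) \<in> G" if "1 \<le> x" "x \<le> k" for x
    using xz[OF that] ncrelD(4)[OF nc] by blast
  have gap': "(?z, j) \<notin> G" if "k < j" "j \<le> n" for j
    using gap[OF that] ncrelD(4)[OF nc] by blast
  have zz: "(?z, ?z) \<in> G" using ncrelD(3)[OF nc] by simp
  have split: "x \<le> k \<or> k < x \<and> x \<le> n \<or> x = ?z" if "x \<in> {1..?z}" for x
    using that by auto
  have "(x, y) \<in> glue k ?z (G \<inter> {1..k} \<times> {1..k}) (G \<inter> {k+1..n} \<times> {k+1..n}) \<longleftrightarrow> (x, y) \<in> G"
    (is "?l x y \<longleftrightarrow> _") if x: "x \<in> {1..?z}" and y: "y \<in> {1..?z}" for x y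
  proof -
    consider "x \<le> k" "y \<le> k" | "x \<le> k" "k < y" "y \<le> n" | "x \<le> k" "y = ?z"
      | "k < x" "x \<le> n" "y \<le> k" | "k < x" "x \<le> n" "k < y" "y \<le> n" | "k < x" "x \<le> n" "y = ?z"
      | "x = ?z" "y \<le> k" | "x = ?z" "k < y" "y \<le> n" | "x = ?z" "y = ?z"
      using split[OF x] split[OF y] by blast
    then show ?thesis
      using x y k by cases (simp_all add: glue_def sep sep' gap gap' xz zx zz)
  qed
  moreover have "x \<in> {1..?z} \<and> y \<in> {1..?z}" if "(x, y) \<in> G" for x y
    using ncrelD(1,2)[OF nc that] by blast
  moreover have "x \<in> {1..?z} \<and> y \<in> {1..?z}" if "?l x y" for x y
    using that k by (auto simp: glue_def)
  ultimately show ?thesis by (intro equalityI subrelI) blast+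
qed

lemma card_ncrel_pred:
  assumes k: "k \<le> n"
  shows "card (ncrel_pred n k) = card (ncrel {1..k}) * card (ncrel {1..n-k})"
proof -
  have "bij_betw (\<lambda>(E, F). glue k (Suc n) E F) (ncrel {1..k} \<times> ncrel {k+1..n}) (ncrel_pred n k)"
  proof (rule bij_betw_byWitness[where
        f' = "\<lambda>G. (G \<inter> {1..k} \<times> {1..k}, G \<inter> {k+1..n} \<times> {k+1..n})"])
    show "\<forall>P\<in>ncrel {1..k} \<times> ncrel {k+1..n}.
      ((case P of (E, F) \<Rightarrow> glue k (Suc n) E F) \<inter> {1..k} \<times> {1..k},
       (case P of (E, F) \<Rightarrow> glue k (Suc n) E F) \<inter> {k+1..n} \<times> {k+1..n}) = P"
    proof clarify
      fix E F assume E: "E \<in> ncrel {1..k}" and F: "F \<in> ncrel {k+1..n}"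
      have E12: "x \<in> {1..k} \<and> y \<in> {1..k}" if "(x, y) \<in> E" for x y
        using ncrelD(1,2)[OF E that] by blast
      have F12: "x \<in> {k+1..n} \<and> y \<in> {k+1..n}" if "(x, y) \<in> F" for x y
        using ncrelD(1,2)[OF F that] by blast
      show "glue k (Suc n) E F \<inter> {1..k} \<times> {1..k} = E \<and>
            glue k (Suc n) E F \<inter> {k+1..n} \<times> {k+1..n} = F"
        using E12 F12 k by (fastforce simp: glue_def)
    qed
    show "\<forall>G\<in>ncrel_pred n k. (case (G \<inter> {1..k} \<times> {1..k}, G \<inter> {k+1..n} \<times> {k+1..n}) of
        (E, F) \<Rightarrow> glue k (Suc n) E F) = G"
      using glue_restrict[OF _ k] by simp
    show "(\<lambda>(E, F). glue k (Suc n) E F) ` (ncrel {1..k} \<times> ncrel {k+1..n}) \<subseteq> ncrel_pred n k"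
      using glue_in_ncrel_pred[OF _ _ k] by auto
    show "(\<lambda>G. (G \<inter> {1..k} \<times> {1..k}, G \<inter> {k+1..n} \<times> {k+1..n})) ` ncrel_pred n k
        \<subseteq> ncrel {1..k} \<times> ncrel {k+1..n}"
      using k by (auto simp: ncrel_pred_def intro!: ncrel_restrict)
  qed
  then have "card (ncrel_pred n k) = card (ncrel {1..k}) * card (ncrel {k+1..n})"
    by (metis bij_betw_same_card card_cartesian_product)
  also have "{k+1..n} = (\<lambda>x. x + k) ` {1..n-k}"
    using k by (simp only: image_add_atLeastAtMost') simp
  also have "card (ncrel ((\<lambda>x. x + k) ` {1..n-k})) = card (ncrel {1..n-k})"
    by (rule card_ncrel_image) (simp add: strict_mono_def)
  finally show ?thesis .
qed

lemma card_NC_0: "card (NC 0) = 1"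
  by (simp add: NC_def noncrossing_def partition_on_empty cong: conj_cong)

text \<open>
  Classify by the predecessor \<open>k\<close> of the last point in its block: what remains are arbitrary
  non-crossing partitions of the \<open>k\<close> points up to it and of the \<open>n - k\<close> points after it.
\<close>
lemma card_NC_Suc: "card (NC (Suc n)) = (\<Sum>k\<le>n. card (NC k) * card (NC (n - k)))"
proof -
  (* The inserted 0 is the predecessor when n + 1 is the least element of its block. *)
  let ?S = "\<lambda>E. insert 0 {j. j \<le> n \<and> (j, Suc n) \<in> E}"
  have pred: "Max (?S E) = k \<longleftrightarrow> (k = 0 \<or> (k, Suc n) \<in> E) \<and> (\<forall>j. k < j \<longrightarrow> j \<le> n \<longrightarrow> (j, Suc n) \<notin> E)"
    if "k \<le> n" for E k
  proof -
    have "Max (?S E) = k \<longleftrightarrow> k \<in> ?S E \<and> (\<forall>j\<in>?S E. j \<le> k)"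
      by (rule Max_eq_iff) auto
    then show ?thesis using that by (auto simp: not_less[symmetric])
  qed
  have le: "Max (?S E) \<le> n" for E by (subst Max_le_iff) auto
  have "card (ncrel {1..Suc n}) = (\<Sum>E\<in>ncrel {1..Suc n}. 1)" by simp
  also have "\<dots> = (\<Sum>k\<le>n. \<Sum>E\<in>{E \<in> ncrel {1..Suc n}. Max (?S E) = k}. 1)"
    by (rule sum.group[symmetric]) (use le in \<open>auto simp: finite_ncrel\<close>)
  also have "\<dots> = (\<Sum>k\<le>n. card (ncrel_pred n k))"
    by (rule sum.cong) (auto simp: ncrel_pred_def pred)
  also have "\<dots> = (\<Sum>k\<le>n. card (NC k) * card (NC (n - k)))"
    by (rule sum.cong) (simp_all only: atMost_iff card_ncrel_pred card_NC_eq_card_ncrel)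
  finally show ?thesis by (simp only: card_NC_eq_card_ncrel)
qed

section \<open>Catalan numbers\<close>
lemma catalan_Suc: "(real n + 2) * catalan (Suc n) = (4 * real n + 2) * catalan n"
proof -
  have "Suc n * (Suc n * (Suc (Suc (2 * n)) choose Suc n)) = Suc n * (2 * (2 * n + 1) * (2 * n choose n))"
  proof -
    have "Suc n * (Suc (Suc (2 * n)) choose Suc n) = Suc (Suc (2 * n)) * (Suc (2 * n) choose n)"
      by (metis Suc_times_binomial_eq mult.commute)
    moreover have "Suc n * (Suc (2 * n) choose n) = Suc (2 * n) * (2 * n choose n)"
      using binomial_absorb_comp[of "Suc (2*n)" n] by (simp add: Suc_diff_le)
    ultimately show ?thesis by (simp add: algebra_simps)
  qed
  then have "Suc n * (Suc (Suc (2 * n)) choose Suc n) = 2 * (2 * n + 1) * (2 * n choose n)"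
    by (simp only: mult_cancel1) simp
  then have "real (Suc n * (Suc (Suc (2 * n)) choose Suc n)) = real (2 * (2 * n + 1) * (2 * n choose n))"
    by (rule arg_cong)
  then show ?thesis by (simp add: catalan_def field_simps del: binomial_Suc_Suc)
qed

text \<open>
  Segner's recurrence from the closed form, without generating functions. Write \<open>S n\<close> for the
  convolution and \<open>T n\<close> for the same sum weighted by \<open>i\<close>. The symmetry \<open>i \<mapsto> n - i\<close> gives
  \<open>2 * T n = n * S n\<close>, while the ratio of consecutive Catalan numbers expresses
  \<open>T (n + 1) + S (n + 1)\<close> by \<open>T n\<close> and \<open>S n\<close>. Eliminating \<open>T\<close> leaves a recurrence of first order
  for \<open>S\<close>, which the shifted Catalan numbers satisfy as well.
\<close>
lemma catalan_convolution: "(\<Sum>i\<le>n. catalan i * catalan (n - i)) = catalan (Suc n)"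
proof (induction n)
  case 0
  then show ?case by (simp add: catalan_def)
next
  case (Suc n)
  define S where "S m = (\<Sum>i\<le>m. catalan i * catalan (m - i))" for m
  define T where "T m = (\<Sum>i\<le>m. real i * catalan i * catalan (m - i))" for m
  have T: "2 * T m = real m * S m" for m
  proof -
    have "T m = (\<Sum>i\<le>m. real (m - i) * catalan (m - i) * catalan i)"
      unfolding T_def by (subst sum.nat_diff_reindex[symmetric, where n = "Suc m", simplified lessThan_Suc_atMost])
        (auto intro!: sum.cong)
    then have "2 * T m = (\<Sum>i\<le>m. real i * catalan i * catalan (m - i) + real (m - i) * catalan (m - i) * catalan i)"
      by (simp add: T_def sum.distrib)
    also have "\<dots> = (\<Sum>i\<le>m. real m * (catalan i * catalan (m - i)))"
      by (rule sum.cong) (auto simp: of_nat_diff algebra_simps)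
    finally show ?thesis by (simp add: S_def sum_distrib_left)
  qed
  have "T (Suc n) + S (Suc n) = (\<Sum>i\<le>Suc n. (real i + 1) * catalan i * catalan (Suc n - i))"
    by (simp add: T_def S_def sum.distrib algebra_simps)
  also have "\<dots> = catalan (Suc n) + (\<Sum>i\<le>n. (real i + 2) * catalan (Suc i) * catalan (n - i))"
    by (subst sum.atMost_Suc_shift) (simp add: catalan_def[of 0] algebra_simps)
  also have "\<dots> = catalan (Suc n) + (\<Sum>i\<le>n. (4 * real i + 2) * catalan i * catalan (n - i))"
    by (simp only: catalan_Suc)
  also have "\<dots> = catalan (Suc n) + 4 * T n + 2 * S n"
    by (simp add: T_def S_def sum.distrib sum_distrib_left algebra_simps)
  finally have "(real n + 3) * S (Suc n) = 2 * (catalan (Suc n) + (2 * real n + 2) * S n)"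
    using T[of n] T[of "Suc n"] by (simp add: algebra_simps)
  also have "S n = catalan (Suc n)" using Suc by (simp add: S_def)
  finally have "(real n + 3) * S (Suc n) = (real n + 3) * catalan (Suc (Suc n))"
    using catalan_Suc[of "Suc n"] by (simp add: algebra_simps)
  then show ?case by (simp add: S_def)
qed

lemma card_NC: "real (card (NC n)) = catalan n"
proof (induction n rule: less_induct)
  case (less n)
  show ?case
  proof (cases n)
    case 0
    then show ?thesis by (simp add: card_NC_0 catalan_def)
  next
    case (Suc m)
    then have "real (card (NC n)) = (\<Sum>k\<le>m. catalan k * catalan (m - k))"
      using less by (simp add: card_NC_Suc)
    then show ?thesis using Suc by (simp add: catalan_convolution)
  qed
qed

section \<open>Sums dominated by their last term\<close>
lemma catalan_double:
  assumes "n \<ge> 1"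
  shows "2 * catalan n \<le> catalan (Suc n)"
proof -
  have "catalan n \<ge> 0" by (simp add: catalan_def)
  then have "(2 * real n + 4) * catalan n \<le> (4 * real n + 2) * catalan n"
    using assms by (intro mult_right_mono) auto
  also have "\<dots> = (real n + 2) * catalan (Suc n)" by (rule catalan_Suc[symmetric])
  finally have "(real n + 2) * (2 * catalan n) \<le> (real n + 2) * catalan (Suc n)"
    by (simp add: algebra_simps)
  then show ?thesis by (rule mult_left_le_imp_le) simp
qed

lemma two_power_le_catalan:
  assumes "n \<ge> 1"
  shows "2 ^ n \<le> 2 * catalan n"
  using assms
proof (induction n rule: nat_induct_at_least)
  case base
  then show ?case by (simp add: catalan_def)
next
  case (Suc n)
  then show ?case using catalan_double[of n] by simp
qed

text \<open>
  If \<open>g\<close> at least doubles at every step, its partial sums are at most twice their last term. Hence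
  summing the costs of all orders up to \<open>n\<close> loses only a constant factor against order \<open>n\<close> alone.
  The finitely many initial terms of \<open>f\<close> outside the bounds are absorbed since \<open>g\<close> tends to
  infinity.
\<close>
lemma sum_bigtheta_last:
  fixes f g :: "nat \<Rightarrow> real"
  assumes a: "a > 0"
    and bounds: "\<forall>\<^sub>F m in sequentially. a * g m \<le> f m \<and> f m \<le> b * g m"
    and nonneg: "\<And>m. g m \<ge> 0"
    and double: "\<And>m. m \<ge> 1 \<Longrightarrow> 2 * g m \<le> g (Suc m)"
    and g: "filterlim g at_top sequentially"
  shows "(\<lambda>n. \<Sum>m=1..n. f m) \<in> \<Theta>(g)"
proof -
  have sum_g: "(\<Sum>m=1..n. g m) \<le> 2 * g n" for n
  proof (induction n)
    case 0
    then show ?case using nonneg by simp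
  next
    case (Suc n)
    show ?case
    proof (cases "n = 0")
      case True
      then show ?thesis using nonneg[of 1] by simp
    next
      case False
      then show ?thesis using Suc double[of n] by simp
    qed
  qed
  obtain N0 where N0: "\<And>m. m \<ge> N0 \<Longrightarrow> a * g m \<le> f m \<and> f m \<le> b * g m"
    using bounds by (auto simp: eventually_sequentially)
  define N where "N = Suc N0"
  define K where "K = \<bar>\<Sum>m=1..<N. f m\<bar>"
  have f: "a * g m \<le> f m" "f m \<le> \<bar>b\<bar> * g m" "f m \<ge> 0" if "m \<ge> N" for m
  proof -
    show "a * g m \<le> f m" using N0[of m] that by (simp add: N_def)
    then show "f m \<ge> 0" using a nonneg[of m] by (meson mult_nonneg_nonneg less_imp_le order_trans)
    have "b * g m \<le> \<bar>b\<bar> * g m" using nonneg[of m] by (intro mult_right_mono) auto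
    then show "f m \<le> \<bar>b\<bar> * g m" using N0[of m] that by (simp add: N_def)
  qed
  have upper: "(\<Sum>m=1..n. f m) \<le> K + 2 * \<bar>b\<bar> * g n"
    and lower: "(\<Sum>m=1..n. f m) \<ge> a * g n - K" if n: "n \<ge> N" for n
  proof -
    have split: "(\<Sum>m=1..n. f m) = (\<Sum>m=1..<N. f m) + (\<Sum>m=N..n. f m)"
      using n by (subst sum.union_disjoint[symmetric]) (auto simp: N_def intro!: sum.cong)
    have "(\<Sum>m=N..n. f m) \<le> (\<Sum>m=N..n. \<bar>b\<bar> * g m)"
      using f by (intro sum_mono) auto
    also have "\<dots> \<le> (\<Sum>m=1..n. \<bar>b\<bar> * g m)"
      using nonneg by (intro sum_mono2) (auto simp: N_def)
    also have "\<dots> \<le> \<bar>b\<bar> * (2 * g n)"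
      unfolding sum_distrib_left[symmetric] by (intro mult_left_mono sum_g) auto
    finally show "(\<Sum>m=1..n. f m) \<le> K + 2 * \<bar>b\<bar> * g n"
      unfolding split K_def by linarith
    have "a * g n \<le> f n" using f n by blast
    also have "f n \<le> (\<Sum>m=N..n. f m)"
      using f n by (intro member_le_sum) auto
    finally show "(\<Sum>m=1..n. f m) \<ge> a * g n - K"
      unfolding split K_def by linarith
  qed
  have ev: "\<forall>\<^sub>F n in sequentially. n \<ge> N \<and> g n \<ge> K \<and> g n \<ge> 2 * K / a"
    using g eventually_ge_at_top[of N] by (auto simp: filterlim_at_top eventually_conj_iff)
  show ?thesis
  proof (rule bigthetaI)
    show "(\<lambda>n. \<Sum>m=1..n. f m) \<in> O(g)"
    proof (rule bigoI[of _ "1 + 2 * \<bar>b\<bar>"])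
      show "\<forall>\<^sub>F n in sequentially. norm (\<Sum>m=1..n. f m) \<le> (1 + 2 * \<bar>b\<bar>) * norm (g n)"
        using ev
      proof eventually_elim
        case (elim n)
        have "a * g n \<ge> 0" "2 * \<bar>b\<bar> * g n \<ge> 0" using a nonneg[of n] by simp_all
        then have "\<bar>\<Sum>m=1..n. f m\<bar> \<le> g n + 2 * \<bar>b\<bar> * g n"
          using upper[of n] lower[of n] elim by linarith
        then show ?case using nonneg[of n] by (simp add: algebra_simps)
      qed
    qed
    show "(\<lambda>n. \<Sum>m=1..n. f m) \<in> \<Omega>(g)"
    proof (rule landau_omega.bigI[of "a / 2"])
      show "\<forall>\<^sub>F n in sequentially. norm (\<Sum>m=1..n. f m) \<ge> a / 2 * norm (g n)"
        using ev
      proof eventually_elim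
        case (elim n)
        then have "K \<le> a / 2 * g n" using a by (simp add: field_simps)
        then have "a / 2 * g n \<le> \<bar>\<Sum>m=1..n. f m\<bar>"
          using lower[of n] elim by linarith
        then show ?case using nonneg[of n] by simp
      qed
    qed (use a in simp)
  qed
qed

section \<open>Schoolbook multiplication of truncated power series\<close>

text \<open>
  For every pair \<open>(k, i)\<close> in the list, \<open>f\<^sub>i * g\<^sub>k\<^sub>-\<^sub>i\<close> is formed in the scratch register \<open>3 n + 3\<close> and
  added to the accumulator \<open>2 n + 2 + k\<close>. The accumulators come after the inputs and
  initially hold \<open>0\<close>.
\<close>
definition schoolbook :: "nat \<Rightarrow> (nat \<times> nat) list \<Rightarrow> instr list" where
  "schoolbook n ps = concat (map (\<lambda>(k, i).
     [Mult (3 * n + 3) i (n + 1 + (k - i)), Add (2 * n + 2 + k) (2 * n + 2 + k) (3 * n + 3)]) ps)"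

lemma prog_cost_schoolbook: "prog_cost (schoolbook n ps) = 2 * length ps"
  by (induction ps) (auto simp: prog_cost_def schoolbook_def)

text \<open>
  The value found initially in the accumulator is kept general for the induction over the list,
  whose tail starts from the partial sums formed so far.
\<close>
lemma run_schoolbook:
  assumes "\<And>k i. (k, i) \<in> set ps \<Longrightarrow> i \<le> k \<and> k \<le> n"
    and "\<And>r. r \<le> 2 * n + 1 \<Longrightarrow> s r = input_state n f g r"
    and "j \<le> n"
  shows "run (schoolbook n ps) s (2 * n + 2 + j) =
    s (2 * n + 2 + j) + (\<Sum>p\<leftarrow>filter (\<lambda>p. fst p = j) ps. fps_nth f (snd p) * fps_nth g (j - snd p))"
  using assms(1,2)
proof (induction ps arbitrary: s)
  case Nil
  then show ?case by (simp add: run_def schoolbook_def)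
next
  case (Cons p ps)
  obtain k i where p: "p = (k, i)" by (cases p)
  have ki: "i \<le> k" "k \<le> n" using Cons.prems(1)[of k i] p by auto
  define v where "v = fps_nth f i * fps_nth g (k - i)"
  define s' where "s' = s(3 * n + 3 := v, 2 * n + 2 + k := s (2 * n + 2 + k) + v)"
  have "s i = fps_nth f i" "s (n + 1 + (k - i)) = fps_nth g (k - i)"
    using Cons.prems(2)[of i] Cons.prems(2)[of "n + 1 + (k - i)"] ki
    by (auto simp: input_state_def)
  then have "run (schoolbook n (p # ps)) s = run (schoolbook n ps) s'"
    using ki by (simp add: run_def schoolbook_def p s'_def v_def)
  moreover have "run (schoolbook n ps) s' (2 * n + 2 + j) = s' (2 * n + 2 + j) +
      (\<Sum>p\<leftarrow>filter (\<lambda>p. fst p = j) ps. fps_nth f (snd p) * fps_nth g (j - snd p))"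
  proof (rule Cons.IH)
    fix r assume "r \<le> 2 * n + 1"
    then show "s' r = input_state n f g r" using Cons.prems(2)[of r] by (simp add: s'_def)
  qed (use Cons.prems(1) in auto)
  ultimately show ?case
    using assms(3) by (auto simp: p s'_def v_def)
qed

text \<open>
  The program runs through all pairs \<open>i \<le> k \<le> n\<close> in any order. There are at most \<open>(n + 1)\<^sup>2\<close> of
  them, each costing one multiplication and one addition.
\<close>
lemma mult_cost_le: "mult_cost n \<le> 2 * (n + 1)\<^sup>2"
proof -
  let ?P = "{(k, i). i \<le> k \<and> k \<le> n}"
  have sub: "?P \<subseteq> {..n} \<times> {..n}" by auto
  then have fin: "finite ?P" by (rule finite_subset) simp
  then obtain ps where ps: "set ps = ?P" "distinct ps"
    using finite_distinct_list by blast
  have "multiplies_truncated n (schoolbook n ps)"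
    unfolding multiplies_truncated_def
  proof (intro exI[of _ "\<lambda>k. 2 * n + 2 + k"] allI impI)
    fix f g :: "complex fps" and k assume k: "k \<le> n"
    have "run (schoolbook n ps) (input_state n f g) (2 * n + 2 + k) =
        (\<Sum>p\<leftarrow>filter (\<lambda>p. fst p = k) ps. fps_nth f (snd p) * fps_nth g (k - snd p))"
      using ps(1) k by (subst run_schoolbook[where f = f and g = g]) (auto simp: input_state_def)
    also have "\<dots> = (\<Sum>p\<in>{p \<in> ?P. fst p = k}. fps_nth f (snd p) * fps_nth g (k - snd p))"
      using ps by (simp add: sum_list_distinct_conv_sum_set)
    also have "\<dots> = (\<Sum>i=0..k. fps_nth f i * fps_nth g (k - i))"
      by (rule sum.reindex_bij_witness[of _ "Pair k" snd]) (use k in auto)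
    finally show "run (schoolbook n ps) (input_state n f g) (2 * n + 2 + k) = fps_nth (f * g) k"
      by (simp add: fps_mult_nth)
  qed
  then have "mult_cost n \<le> prog_cost (schoolbook n ps)"
    unfolding mult_cost_def by (intro Least_le) blast
  also have "\<dots> = 2 * card ?P"
    using ps distinct_card[of ps] by (simp add: prog_cost_schoolbook)
  also have "\<dots> \<le> 2 * (n + 1)\<^sup>2"
    using card_mono[OF _ sub] by (simp add: power2_eq_square)
  finally show ?thesis .
qed

section \<open>Comparison of the costs\<close>
lemma square_smallo_catalan:
  "(\<lambda>n. real n ^ 2) \<in> o(\<lambda>n. real n * catalan n)"
proof -
  have "(\<lambda>n. real n / 2 ^ n) \<longlonglongrightarrow> 0"
    using lim_n_over_pown[of "2::real"] by simp
  then have "(\<lambda>n. real n) \<in> o(\<lambda>n. 2 ^ n)"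
    by (intro smalloI_tendsto) auto
  also have "(\<lambda>n. 2 ^ n) \<in> O(catalan)"
    by (rule bigoI[of _ 2])
      (use eventually_ge_at_top[of 1] in eventually_elim, use two_power_le_catalan in \<open>force simp: catalan_def\<close>)
  finally have "(\<lambda>n. real n * real n) \<in> o(\<lambda>n. real n * catalan n)"
    by (intro landau_o.big_small_mult) auto
  then show ?thesis by (simp add: power2_eq_square)
qed

lemma mult_cost_smallo: "(\<lambda>n. real (mult_cost n)) \<in> o(\<lambda>n. real n * catalan n)"
proof -
  have "\<forall>\<^sub>F n in sequentially. norm (real (mult_cost n)) \<le> 8 * norm (real n ^ 2)"
    using eventually_ge_at_top[of 1]
  proof eventually_elim
    case (elim n)
    have "(n + 1)\<^sup>2 \<le> (2 * n)\<^sup>2" using elim by (intro power_mono) auto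
    then have "mult_cost n \<le> 8 * n\<^sup>2" using mult_cost_le[of n] by (simp add: power_mult_distrib)
    then have "real (mult_cost n) \<le> real (8 * n\<^sup>2)" by (rule of_nat_mono)
    then show ?case by simp
  qed
  then have "(\<lambda>n. real (mult_cost n)) \<in> O(\<lambda>n. real n ^ 2)" by (rule bigoI)
  then show ?thesis using square_smallo_catalan by (rule landau_o.big_small_trans)
qed

lemma L_classical_bigtheta:
  assumes "linear_time t"
  shows "L_classical t \<kappa> \<in> \<Theta>(\<lambda>n. real n * catalan n)"
proof -
  obtain a b where a: "a > 0" and ev: "\<forall>\<^sub>F m in sequentially.
      \<forall>\<pi>\<in>NC m. a * real m \<le> t m \<pi> \<and> t m \<pi> \<le> b * real m"
    using assms unfolding linear_time_def by blast
  have "L_classical t \<kappa> = (\<lambda>n. \<Sum>m=1..n. \<Sum>\<pi>\<in>NC m. t m \<pi>)"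
    by (simp add: fun_eq_iff L_classical_def classical_moments_def classical_moment_def)
  also have "\<dots> \<in> \<Theta>(\<lambda>n. real n * catalan n)"
  proof (rule sum_bigtheta_last[OF a])
    show "\<forall>\<^sub>F m in sequentially. a * (real m * catalan m) \<le> (\<Sum>\<pi>\<in>NC m. t m \<pi>) \<and>
        (\<Sum>\<pi>\<in>NC m. t m \<pi>) \<le> b * (real m * catalan m)"
      using ev
    proof eventually_elim
      case (elim m)
      have "real (card (NC m)) * (a * real m) \<le> (\<Sum>\<pi>\<in>NC m. t m \<pi>)"
        using elim by (intro sum_bounded_below) auto
      moreover have "(\<Sum>\<pi>\<in>NC m. t m \<pi>) \<le> real (card (NC m)) * (b * real m)"
        using elim by (intro sum_bounded_above) auto
      ultimately show ?case by (simp add: card_NC mult_ac)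
    qed
    show "real m * catalan m \<ge> 0" for m by (simp add: catalan_def)
    show "2 * (real m * catalan m) \<le> real (Suc m) * catalan (Suc m)" if "m \<ge> 1" for m
    proof -
      have "real m * (2 * catalan m) \<le> real (Suc m) * catalan (Suc m)"
        using catalan_double[OF that] by (intro mult_mono) (auto simp: catalan_def)
      then show ?thesis by simp
    qed
    show "filterlim (\<lambda>n. real n * catalan n) at_top sequentially"
    proof (rule filterlim_at_top_mono[OF filterlim_real_sequentially])
      show "\<forall>\<^sub>F n in sequentially. real n \<le> real n * catalan n"
        using eventually_ge_at_top[of 1]
      proof eventually_elim
        case (elim n)
        have "(2::real) ^ 1 \<le> 2 ^ n" using elim by (intro power_increasing) auto
        then have "1 \<le> catalan n" using two_power_le_catalan[OF elim] by simp
        then show ?case by (simp add: mult_le_cancel_left1)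
      qed
    qed
  qed
  finally show ?thesis .
qed

theorem propositionC2:
  fixes t :: "nat \<Rightarrow> nat set set \<Rightarrow> real" and \<kappa> :: "nat \<Rightarrow> complex"
  assumes "linear_time t"
  shows "L_classical t \<kappa> \<in> \<Theta>(\<lambda>n. real n * catalan n) \<and>
         \<Theta>(\<lambda>n. real n * catalan n) \<subseteq> \<omega>(\<lambda>n. real (mult_cost n))"
proof (intro conjI subsetI)
  show "L_classical t \<kappa> \<in> \<Theta>(\<lambda>n. real n * catalan n)"
    using assms by (rule L_classical_bigtheta)
  fix h :: "nat \<Rightarrow> real" assume "h \<in> \<Theta>(\<lambda>n. real n * catalan n)"
  then have "(\<lambda>n. real (mult_cost n)) \<in> o(h)"
    using mult_cost_smallo landau_o.small.cong_bigtheta by blast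
  then show "h \<in> \<omega>(\<lambda>n. real (mult_cost n))"
    by (simp add: smallomega_iff_smallo)
qed

end
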